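(* Let $G$ be an acyclic graph (a forest) and let $A$ be a real symmetric matrix with $G(A)=G$. Then the following are equivalent: (a) $A$ is copositive; (b) $A$ is SPN; (c) $N(A)$ is positive semidefinite.
   Context: A real symmetric matrix $A$ is copositive if $x^TAx\ge 0$ for every entrywise nonnegative vector $x$. A real symmetric matrix is SPN if it is the sum of a real positive semidefinite matrix and a symmetric entrywise nonnegative matrix. The graph $G(A)$ of a real symmetric $n\times n$ matrix $A$ is the simple graph with vertices $\{1,\dots,n\}$ in which $ij$ ($i\ne j$) is an edge if and only if $a_{ij}\neq 0$. For a real symmetric matrix $A$, $N(A)$ is the symmetric matrix of the same order given by $(N(A))_{ij}=a_{ij}$ if $i=j$ or $a_{ij}<0$, and $(N(A))_{ij}=0$ if $i\ne j$ and $a_{ij}\ge 0$. *)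

theory Defs
  imports "HOL-Analysis.Analysis" "Graph_Theory.Pair_Digraph" "Graph_Theory.Arc_Walk"
begin

text \<open>
  Order-\<open>n\<close> matrices are values of type \<open>real ^ 'n ^ 'n\<close> with \<open>n = CARD('n)\<close>; the finite index
  type plays the role of \<open>{1, \<dots>, n}\<close>.
\<close>

definition symmetric_matrix :: "real ^ 'n ^ 'n \<Rightarrow> bool" where
  "symmetric_matrix A \<longleftrightarrow> transpose A = A"

definition nonneg_vector :: "real ^ 'n \<Rightarrow> bool" where
  "nonneg_vector x \<longleftrightarrow> (\<forall>i. 0 \<le> x $ i)"

definition nonneg_matrix :: "real ^ 'n ^ 'n \<Rightarrow> bool" where
  "nonneg_matrix A \<longleftrightarrow> (\<forall>i j. 0 \<le> A $ i $ j)"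

definition copositive :: "real ^ 'n ^ 'n \<Rightarrow> bool" where
  "copositive A \<longleftrightarrow>
     symmetric_matrix A \<and> (\<forall>x. nonneg_vector x \<longrightarrow> 0 \<le> x \<bullet> (A *v x))"

definition positive_semidefinite :: "real ^ 'n ^ 'n \<Rightarrow> bool" where
  "positive_semidefinite A \<longleftrightarrow> symmetric_matrix A \<and> (\<forall>x. 0 \<le> x \<bullet> (A *v x))"

definition SPN :: "real ^ 'n ^ 'n \<Rightarrow> bool" where
  "SPN A \<longleftrightarrow> symmetric_matrix A \<and>
     (\<exists>P M. positive_semidefinite P \<and> symmetric_matrix M \<and> nonneg_matrix M \<and> A = P + M)"

definition diag_neg_part :: "real ^ 'n ^ 'n \<Rightarrow> real ^ 'n ^ 'n" where
  "diag_neg_part A = (\<chi> i j. if i = j \<or> A $ i $ j < 0 then A $ i $ j else 0)"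

text \<open>
  A simple graph is, as in the library, a finite symmetric loop-free digraph (\<^locale>\<open>pair_graph\<close>):
  an edge \<open>ij\<close> is represented by the two arcs \<open>(i, j)\<close> and \<open>(j, i)\<close>. For a symmetric matrix the
  following digraph is such a graph.
\<close>

definition matrix_graph :: "real ^ 'n ^ 'n \<Rightarrow> 'n pair_pre_digraph" where
  "matrix_graph A = \<lparr>pverts = UNIV, parcs = {(i, j). i \<noteq> j \<and> A $ i $ j \<noteq> 0}\<rparr>"

text \<open>
  The library's \<^const>\<open>pre_digraph.cycle\<close> is a nonempty closed walk without repeated vertices, so
  walking along an edge and back counts as a cycle of length 2, and the library's notion of forest
  for digraphs excludes every edge of a symmetric digraph. Cycles of an undirected simple graph
  are those of length at least 3.
\<close>

definition acyclic_graph :: "'a pair_pre_digraph \<Rightarrow> bool" where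
  "acyclic_graph G \<longleftrightarrow> \<not> (\<exists>p. pre_digraph.cycle (with_proj G) p \<and> 3 \<le> length p)"

lemma pair_graph_matrix_graph:
  fixes A :: "real ^ 'n::finite ^ 'n"
  assumes "symmetric_matrix A"
  shows "pair_graph (matrix_graph A)"
proof -
  have "A $ i $ j = A $ j $ i" for i j
    using assms unfolding symmetric_matrix_def transpose_def
    by (metis vec_lambda_beta)
  then show ?thesis
    by unfold_locales (auto simp: matrix_graph_def symmetric_def intro!: symI)
qed

end

theory Submission
  imports Defs
begin

text \<open>
  Write \<open>N\<close> for \<^term>\<open>diag_neg_part A\<close>. That semidefiniteness of \<open>N\<close> gives a decomposition
  \<open>A = N + (A - N)\<close>, and that such a decomposition gives copositivity, holds for every symmetric
  matrix. The forest enters only in deducing semidefiniteness of \<open>N\<close> from copositivity of \<open>A\<close>.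

  Since the off-diagonal entries of \<open>N\<close> are nonpositive, replacing a vector by its entrywise
  absolute value can only decrease the quadratic form of \<open>N\<close>, so it suffices that \<open>N\<close> is
  copositive (\<open>positive_semidefinite_if_copositive_offdiag_nonpos\<close>). Now split the vertices into
  the components of the graph formed by the negative entries. Then \<open>N\<close> is block diagonal with
  respect to these components. Two vertices of one component are joined by a path of negative
  edges, and a positive edge between them would close that path to a cycle; so in a forest the
  blocks of \<open>N\<close> are principal submatrices of \<open>A\<close>
  (\<open>acyclic_graph_arc_in_connecting_relation\<close>). The quadratic form of \<open>N\<close> at \<open>x \<ge> 0\<close> is
  therefore the sum of the values of the form of \<open>A\<close> at the restrictions of \<open>x\<close> to the
  components, and these restrictions are nonnegative.
\<close>

lemma inner_matrix_vector_mult_self: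
  fixes A :: "real ^ 'n::finite ^ 'n"
  shows "x \<bullet> (A *v x) = (\<Sum>i\<in>UNIV. \<Sum>j\<in>UNIV. A $ i $ j * (x $ i * x $ j))"
  by (simp add: inner_vec_def matrix_vector_mult_def sum_distrib_left mult_ac)

lemma symmetric_matrixD: "symmetric_matrix A \<Longrightarrow> A $ i $ j = A $ j $ i"
  unfolding symmetric_matrix_def transpose_def by (metis vec_lambda_beta)

lemma symmetric_matrixI: "(\<And>i j. A $ i $ j = A $ j $ i) \<Longrightarrow> symmetric_matrix A"
  by (simp add: symmetric_matrix_def transpose_def vec_eq_iff)

lemma symmetric_matrix_diag_neg_part:
  assumes "symmetric_matrix A"
  shows "symmetric_matrix (diag_neg_part A)"
  by (rule symmetric_matrixI)
    (use symmetric_matrixD[OF assms] in \<open>simp add: diag_neg_part_def\<close>)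

lemma SPN_if_positive_semidefinite_diag_neg_part:
  fixes A :: "real ^ 'n::finite ^ 'n"
  assumes "symmetric_matrix A" and "positive_semidefinite (diag_neg_part A)"
  shows "SPN A"
proof -
  have "nonneg_matrix (A - diag_neg_part A)"
    by (simp add: nonneg_matrix_def diag_neg_part_def)
  moreover have "symmetric_matrix (A - diag_neg_part A)"
    using symmetric_matrixD[OF assms(1)]
      symmetric_matrixD[OF symmetric_matrix_diag_neg_part[OF assms(1)]]
    by (intro symmetric_matrixI) simp
  ultimately show ?thesis
    using assms unfolding SPN_def
    by (metis add_diff_cancel_left' diff_add_cancel add.commute)
qed

lemma copositive_if_SPN:
  fixes A :: "real ^ 'n::finite ^ 'n"
  assumes "SPN A"
  shows "copositive A"
  unfolding copositive_def
proof (intro conjI allI impI)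
  show "symmetric_matrix A"
    using assms by (simp add: SPN_def)
  fix x :: "real ^ 'n"
  assume x: "nonneg_vector x"
  obtain P M where P: "positive_semidefinite P" and M: "nonneg_matrix M" and A: "A = P + M"
    using assms unfolding SPN_def by blast
  have "0 \<le> x \<bullet> (P *v x)"
    using P by (simp add: positive_semidefinite_def)
  moreover have "0 \<le> x \<bullet> (M *v x)"
    using x M unfolding inner_matrix_vector_mult_self nonneg_matrix_def nonneg_vector_def
    by (intro sum_nonneg mult_nonneg_nonneg) auto
  ultimately show "0 \<le> x \<bullet> (A *v x)"
    by (simp add: A matrix_vector_mult_add_rdistrib inner_add_right)
qed

text \<open>
  For \<open>i \<noteq> j\<close>, replacing \<open>x\<^sub>i x\<^sub>j\<close> by \<open>\<bar>x\<^sub>i\<bar> \<bar>x\<^sub>j\<bar>\<close> decreases a term with a nonpositive coefficient,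
  while diagonal terms depend only on the squares \<open>x\<^sub>i\<^sup>2\<close>. So the form is smallest, among all sign
  changes of \<open>x\<close>, at the nonnegative one.
\<close>

lemma positive_semidefinite_if_copositive_offdiag_nonpos:
  fixes B :: "real ^ 'n::finite ^ 'n"
  assumes "copositive B" and offdiag: "\<And>i j. i \<noteq> j \<Longrightarrow> B $ i $ j \<le> 0"
  shows "positive_semidefinite B"
  unfolding positive_semidefinite_def
proof (intro conjI allI)
  show "symmetric_matrix B"
    using assms(1) by (simp add: copositive_def)
  fix x :: "real ^ 'n"
  define y :: "real ^ 'n" where "y = (\<chi> i. \<bar>x $ i\<bar>)"
  have "B $ i $ j * (y $ i * y $ j) \<le> B $ i $ j * (x $ i * x $ j)" for i j
  proof (cases "i = j")
    case False
    have "x $ i * x $ j \<le> \<bar>x $ i\<bar> * \<bar>x $ j\<bar>"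
      by (metis abs_ge_self abs_mult)
    then show ?thesis
      using offdiag[OF False] by (simp add: y_def mult_left_mono_neg)
  qed (simp add: y_def)
  then have "y \<bullet> (B *v y) \<le> x \<bullet> (B *v x)"
    unfolding inner_matrix_vector_mult_self by (intro sum_mono)
  moreover have "0 \<le> y \<bullet> (B *v y)"
    using assms(1) by (simp add: copositive_def nonneg_vector_def y_def)
  ultimately show "0 \<le> x \<bullet> (B *v x)"
    by linarith
qed

text \<open>
  Vertices connected by \<open>S\<close> are connected by a path with arcs in \<open>S\<close>; if \<open>(i, j)\<close> were not itself in
  \<open>S\<close>, this path would have at least two arcs, and the arc \<open>(j, i)\<close> would complete it to a cycle of
  length at least three.
\<close>

lemma acyclic_graph_arc_in_connecting_relation:
  assumes "pair_graph G" and "acyclic_graph G"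
    and S: "S \<subseteq> parcs G" and conn: "(i, j) \<in> S\<^sup>*" and arc: "(i, j) \<in> parcs G"
  shows "(i, j) \<in> S"
proof (rule ccontr)
  assume notin: "(i, j) \<notin> S"
  interpret G: pair_graph G by fact
  define H where "H = \<lparr>pverts = pverts G, parcs = S\<rparr>"
  interpret H: pair_wf_digraph H
    using S by unfold_locales (auto simp: H_def dest!: subsetD dest: G.in_arcsD1 G.in_arcsD2)
  have ji: "(j, i) \<in> parcs G" and ne: "i \<noteq> j"
    using arc G.pair_sym_arcs G.pair_no_loops[OF arc] by (auto simp: symmetric_def dest: symD)
  have "(i, j) \<in> (parcs H)\<^sup>+"
    using conn ne by (simp add: H_def rtrancl_eq_or_trancl)
  then have "i \<rightarrow>\<^sup>*\<^bsub>with_proj H\<^esub> j"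
    by (rule H.reachable1_reachable)
  then obtain p where "H.apath i p j"
    using H.reachable_apath by blast
  then have p: "set p \<subseteq> S" "pcas i p j" "distinct (pawalk_verts i p)"
    unfolding H.apath_def H.awalk_def by (simp_all add: H_def)
  have "G.awalk j ((j, i) # p) j"
    using p S ji by (auto simp: G.awalk_def dest: G.in_arcsD1)
  then have "G.cycle ((j, i) # p)"
    unfolding G.cycle_def using p(3) by (intro exI[of _ j]) simp
  moreover have "2 \<le> length p"
    using p notin ne by (cases p rule: remdups_adj.cases) auto
  ultimately show False
    using \<open>acyclic_graph G\<close> unfolding acyclic_graph_def
    by (metis length_Cons Suc_le_mono eval_nat_numeral(3))
qed

text \<open>
  The sum below runs over all sets of vertices \<open>C\<close>; those that are not components of the graph of
  negative entries contribute the zero vector. For fixed \<open>i\<close> and \<open>j\<close>, exactly one \<open>C\<close> contributes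
  when they share a component and none otherwise.
\<close>

lemma copositive_diag_neg_part:
  fixes A :: "real ^ 'n::finite ^ 'n"
  assumes forest: "acyclic_graph (matrix_graph A)" and "copositive A"
  shows "copositive (diag_neg_part A)"
  unfolding copositive_def
proof (intro conjI allI impI)
  have sym: "symmetric_matrix A"
    using \<open>copositive A\<close> by (simp add: copositive_def)
  then show "symmetric_matrix (diag_neg_part A)"
    by (rule symmetric_matrix_diag_neg_part)
  fix x :: "real ^ 'n"
  assume x: "nonneg_vector x"
  define S where "S = {(i, j). i \<noteq> j \<and> A $ i $ j < 0}"
  define component where "component i = S\<^sup>* `` {i}" for i
  define restr :: "'n set \<Rightarrow> real ^ 'n" where
    "restr C = (\<chi> i. if component i = C then x $ i else 0)" for C
  have "sym (S\<^sup>*)"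
    using symmetric_matrixD[OF sym] by (intro sym_rtrancl) (auto simp: S_def sym_def)
  then have component_eqI: "component i = component j" if "(i, j) \<in> S\<^sup>*" for i j
    using that by (auto simp: component_def dest: symD intro: rtrancl_trans)
  have component_eqD: "(i, j) \<in> S\<^sup>*" if "component i = component j" for i j
    using that by (auto simp: component_def)
  have restr_sum: "(\<Sum>C\<in>UNIV. restr C $ i * restr C $ j)
      = (if component i = component j then x $ i * x $ j else 0)" for i j
  proof -
    have "(\<Sum>C\<in>UNIV. restr C $ i * restr C $ j)
        = (\<Sum>C\<in>UNIV. if component i = C then x $ i * (if component j = C then x $ j else 0) else 0)"
      by (intro sum.cong) (auto simp: restr_def)
    then show ?thesis
      by simp
  qed
  have entry: "diag_neg_part A $ i $ j * (x $ i * x $ j)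
      = A $ i $ j * (\<Sum>C\<in>UNIV. restr C $ i * restr C $ j)" for i j
  proof -
    consider "i = j" | "A $ i $ j = 0" | "i \<noteq> j" "A $ i $ j < 0" | "i \<noteq> j" "A $ i $ j > 0"
      by linarith
    then show ?thesis
    proof cases
      case 3
      then have "component i = component j"
        by (intro component_eqI) (auto simp: S_def)
      then show ?thesis
        using 3 by (simp add: restr_sum diag_neg_part_def)
    next
      case 4
      have "component i \<noteq> component j"
      proof
        assume "component i = component j"
        then have "(i, j) \<in> S"
          using 4 by (intro acyclic_graph_arc_in_connecting_relation
              [OF pair_graph_matrix_graph[OF sym] forest _ component_eqD])
            (auto simp: S_def matrix_graph_def)
        then show False
          using 4 by (simp add: S_def)
      qed
      then show ?thesis
        using 4 by (simp add: restr_sum diag_neg_part_def)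
    qed (auto simp: restr_sum diag_neg_part_def)
  qed
  have "x \<bullet> (diag_neg_part A *v x)
      = (\<Sum>i\<in>UNIV. \<Sum>j\<in>UNIV. \<Sum>C\<in>UNIV. A $ i $ j * (restr C $ i * restr C $ j))"
    by (simp add: inner_matrix_vector_mult_self entry sum_distrib_left)
  also have "\<dots> = (\<Sum>i\<in>UNIV. \<Sum>C\<in>UNIV. \<Sum>j\<in>UNIV. A $ i $ j * (restr C $ i * restr C $ j))"
    by (intro sum.cong refl sum.swap)
  also have "\<dots> = (\<Sum>C\<in>UNIV. restr C \<bullet> (A *v restr C))"
    unfolding inner_matrix_vector_mult_self by (rule sum.swap)
  also have "\<dots> \<ge> 0"
    using x \<open>copositive A\<close>
    by (intro sum_nonneg) (simp add: copositive_def nonneg_vector_def restr_def)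
  finally show "0 \<le> x \<bullet> (diag_neg_part A *v x)" .
qed

theorem theorem5p4:
  fixes G :: "'n::finite pair_pre_digraph"
    and A :: "real ^ 'n ^ 'n"
  assumes "pair_graph G"
    and "acyclic_graph G"
    and "symmetric_matrix A"
    and "matrix_graph A = G"
  shows "(copositive A \<longleftrightarrow> SPN A) \<and> (SPN A \<longleftrightarrow> positive_semidefinite (diag_neg_part A))"
proof -
  have "positive_semidefinite (diag_neg_part A)" if "copositive A"
    using assms that
    by (intro positive_semidefinite_if_copositive_offdiag_nonpos copositive_diag_neg_part)
      (auto simp: diag_neg_part_def)
  then show ?thesis
    using SPN_if_positive_semidefinite_diag_neg_part[OF assms(3)] copositive_if_SPN by blast
qed

end
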